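(* For any non-trivial connected bipartite graph $G$ and any integer $t\ge 4D(G)$, $$\dim_l(C_t\boxtimes G)\le \left\lceil\frac{t}{D(G)}\right\rceil+1.$$ Furthermore, if $\left\lceil\frac{t}{D(G)}\right\rceil$ is even, then $\dim_l(C_t\boxtimes G)=\left\lceil\frac{t}{D(G)}\right\rceil$.
   Context: $C_t$ is the cycle on $t$ vertices and $D(G)$ is the diameter of $G$. A set $S$ is a local metric generator for a connected graph $X$ if for every two adjacent vertices $x,y$ there is $s\in S$ with $d_X(s,x)\ne d_X(s,y)$; $\dim_l(X)$ is the minimum cardinality of a local metric generator. The strong product $C_t\boxtimes G$ has vertex set $V(C_t)\times V(G)$, with $(a,b)\sim(c,d)$ iff ($a=c$ and $b\sim d$) or ($b=d$ and $a\sim c$) or ($a\sim c$ and $b\sim d$). *)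

theory Defs
  imports "Graph_Theory.Pair_Digraph" "Graph_Theory.Digraph_Component"
    "Graph_Theory.Shortest_Path"
begin

text \<open>
  Finite simple graphs are values of type \<^typ>\<open>'a pair_pre_digraph\<close> satisfying
  \<^const>\<open>pair_graph\<close> (finite, loop-free, symmetric), so an undirected edge is a pair of
  opposite arcs and \<open>(u, v) \<in> parcs G\<close> is adjacency.
\<close>

text \<open>
  Distances are natural numbers; \<open>LEAST\<close> is unspecified when no walk exists, so the
  definition is meant for connected graphs.
\<close>

definition graph_dist :: "'a pair_pre_digraph \<Rightarrow> 'a \<Rightarrow> 'a \<Rightarrow> nat" where
  "graph_dist G u v = (LEAST n. \<exists>p. pre_digraph.awalk G u p v \<and> length p = n)"

definition graph_diameter :: "'a pair_pre_digraph \<Rightarrow> nat" where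
  "graph_diameter G = Max {graph_dist G u v | u v. u \<in> pverts G \<and> v \<in> pverts G}"

definition bipartite :: "'a pair_pre_digraph \<Rightarrow> bool" where
  "bipartite G \<longleftrightarrow> (\<exists>A B. A \<union> B = pverts G \<and> A \<inter> B = {} \<and>
     (\<forall>(u, v) \<in> parcs G. u \<in> A \<and> v \<in> B \<or> u \<in> B \<and> v \<in> A))"

text \<open>The graph \<open>C\<^sub>t\<close> on \<open>{0, \<dots>, t - 1}\<close>; it is a cycle, and simple, only for \<open>t \<ge> 3\<close>.\<close>

definition cycle_graph :: "nat \<Rightarrow> nat pair_pre_digraph" where
  "cycle_graph t = \<lparr> pverts = {..<t},
     parcs = {(i, j). i < t \<and> j < t \<and> (j = Suc i mod t \<or> i = Suc j mod t)} \<rparr>"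

definition strong_product ::
    "'a pair_pre_digraph \<Rightarrow> 'b pair_pre_digraph \<Rightarrow> ('a \<times> 'b) pair_pre_digraph"
    (infixr \<open>\<boxtimes>\<close> 75) where
  "G \<boxtimes> H = \<lparr> pverts = pverts G \<times> pverts H,
     parcs = {((a, b), (c, d)). a \<in> pverts G \<and> b \<in> pverts H \<and> c \<in> pverts G \<and> d \<in> pverts H \<and>
       (a = c \<and> (b, d) \<in> parcs H \<or> b = d \<and> (a, c) \<in> parcs G
        \<or> (a, c) \<in> parcs G \<and> (b, d) \<in> parcs H)} \<rparr>"

definition local_metric_generator :: "'a pair_pre_digraph \<Rightarrow> 'a set \<Rightarrow> bool" where
  "local_metric_generator G S \<longleftrightarrow> S \<subseteq> pverts G \<and>
     (\<forall>(x, y) \<in> parcs G. \<exists>s \<in> S. graph_dist G s x \<noteq> graph_dist G s y)"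

definition local_metric_dim :: "'a pair_pre_digraph \<Rightarrow> nat" (\<open>dim\<^sub>l\<close>) where
  "dim\<^sub>l G = (LEAST n. \<exists>S. finite S \<and> local_metric_generator G S \<and> card S = n)"


text \<open>The constructions yield simple graphs, and distance agrees with \<^const>\<open>wf_digraph.\<mu>\<close>.\<close>

lemma pair_graph_cycle_graph: "3 \<le> t \<Longrightarrow> pair_graph (cycle_graph t)"
proof (unfold_locales, goal_cases)
  case 4
  then show ?case
    by (rule_tac finite_subset[of _ "{..<t} \<times> {..<t}"]) (auto simp: cycle_graph_def)
next
  case (5 e)
  have "Suc i mod t \<noteq> i" if "i < t" for i
    using that 5(1) by (cases "Suc i = t") auto
  with 5 show ?case by (force simp: cycle_graph_def)
qed (auto simp: cycle_graph_def symmetric_def sym_def)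

lemma pair_graph_strong_product:
  assumes "pair_graph G" "pair_graph H"
  shows "pair_graph (G \<boxtimes> H)"
proof -
  interpret G: pair_graph G by fact
  interpret H: pair_graph H by fact
  have fin: "finite ((pverts G \<times> pverts H) \<times> (pverts G \<times> pverts H))"
    using G.pair_finite_verts H.pair_finite_verts by simp
  show ?thesis
  proof (unfold_locales, goal_cases)
    case 4
    then show ?case
      by (rule finite_subset[OF _ fin]) (auto simp: strong_product_def)
  next
    case 6
    show ?case
      using G.sym_arcs H.sym_arcs
      by (auto simp: strong_product_def symmetric_def sym_def)
  qed (use G.pair_finite_verts H.pair_finite_verts in
        \<open>auto simp: strong_product_def dest: G.pair_no_loops H.pair_no_loops\<close>)
qed

lemma graph_dist_eq_mu:
  assumes "pair_graph G" "connected G" "u \<in> pverts G" "v \<in> pverts G"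
  shows "ereal (graph_dist G u v) = wf_digraph.\<mu> G (\<lambda>_. 1) u v"
proof -
  interpret pair_graph G by fact
  have cost: "awalk_cost (\<lambda>_. 1) p = real (length p)" for p :: "('a \<times> 'a) list"
    by (simp add: awalk_cost_def sum_list_triv)
  have "parcs G = parcs (mk_symmetric G)"
    using sym_arcs by (force simp: mk_symmetric_def symmetric_def sym_def)
  then have "mk_symmetric G = G"
    by (simp add: mk_symmetric_def)
  then have "strongly_connected G"
    using assms(2) by (simp add: connected_def)
  then obtain p where p: "awalk u p v"
    using assms(3,4) by (auto simp: strongly_connected_def reachable_awalk)
  let ?P = "\<lambda>n. \<exists>p. awalk u p v \<and> length p = n"
  have ex: "?P (graph_dist G u v)"
    unfolding graph_dist_def by (rule LeastI[of ?P "length p"]) (use p in blast)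
  have le: "graph_dist G u v \<le> length q" if "awalk u q v" for q
    unfolding graph_dist_def by (rule Least_le) (use that in blast)
  show ?thesis
    unfolding \<mu>_def cost using ex le
    by (intro antisym INF_greatest) (auto intro: INF_lower2)
qed

end

theory Submission
  imports Defs
begin

text \<open>
  Distance in \<open>C\<^sub>t \<boxtimes> G\<close> is the maximum of the two coordinate distances; let \<open>D\<close> be the diameter
  of \<open>G\<close>. Adjacent vertices of the bipartite graph \<open>G\<close> have distances of different parity from
  any vertex, so \<open>(i, g)\<close> resolves an edge \<open>(a, b)(a, d)\<close> iff \<open>i\<close> is closer to \<open>a\<close> than \<open>g\<close> is to
  the farther of \<open>b\<close> and \<open>d\<close>.

  Upper bound: place vertices around the cycle with gaps at most \<open>D\<close> and second coordinates
  alternating between diametral vertices \<open>u\<close> and \<open>v\<close>; this needs evenly many of them. If both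
  neighbours of a column \<open>a\<close> failed on the edge \<open>bd\<close>, then \<open>b\<close> and \<open>d\<close> would both lie on geodesics
  from \<open>u\<close> to \<open>v\<close> at the same distance from \<open>u\<close>, against parity. An edge between different columns
  is resolved by a chosen vertex at cycle distance between \<open>D + 1\<close> and \<open>2 D \<le> t / 2\<close>.

  Lower bound: let \<open>(i, g)\<close> give weight 1 to every column at distance less than \<open>D\<close> from \<open>i\<close>, and
  one more to column \<open>i\<close>, in total at most \<open>2 D\<close>. Every column needs weight 2, because
  \<open>(i, g)\<close> with \<open>i \<noteq> a\<close> resolves no edge at \<open>g\<close> in column \<open>a\<close>.
\<close>

section \<open>Distance functions\<close>

text \<open>A local description of the distance function from \<open>u\<close>. All conditions
  concern single arcs, so a candidate formula for a distance can be verified without building walks.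
  Every vertex other than \<open>u\<close> having a neighbour one step nearer is what makes
  \<open>f\<close> attainable by walks.\<close>

definition distance_from :: "'a pair_pre_digraph \<Rightarrow> 'a \<Rightarrow> ('a \<Rightarrow> nat) \<Rightarrow> bool" where
  "distance_from G u f \<longleftrightarrow> u \<in> pverts G \<and> f u = 0 \<and>
     (\<forall>(w, v) \<in> parcs G. f v \<le> Suc (f w)) \<and>
     (\<forall>v \<in> pverts G - {u}. \<exists>w. (w, v) \<in> parcs G \<and> f v = Suc (f w))"

lemma distance_from_arc: "distance_from G u f \<Longrightarrow> (w, v) \<in> parcs G \<Longrightarrow> f v \<le> Suc (f w)"
  by (auto simp: distance_from_def)

lemma distance_from_pred:
  assumes "distance_from G u f" "v \<in> pverts G" "v \<noteq> u"
  obtains w where "(w, v) \<in> parcs G" "f v = Suc (f w)"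
  using assms by (auto simp: distance_from_def)

lemma distance_from_eq_0_iff:
  assumes "distance_from G u f" "v \<in> pverts G"
  shows "f v = 0 \<longleftrightarrow> v = u"
proof
  assume "f v = 0"
  then show "v = u" using distance_from_pred[OF assms] by (metis Zero_neq_Suc)
qed (use assms in \<open>simp add: distance_from_def\<close>)

text \<open>Induction along a geodesic from \<open>u\<close>: stepping to a predecessor lowers
  \<open>f\<close> by one, so the descent can stop only at \<open>u\<close>.\<close>

lemma distance_from_induct [consumes 3, case_names start arc]:
  assumes "pair_graph G" "distance_from G u f" "v \<in> pverts G"
    and start: "P u"
    and arc: "\<And>w v. (w, v) \<in> parcs G \<Longrightarrow> f v = Suc (f w) \<Longrightarrow> P w \<Longrightarrow> P v"
  shows "P v"
  using \<open>v \<in> pverts G\<close>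
proof (induction "f v" arbitrary: v rule: less_induct)
  case less
  interpret pair_graph G by fact
  show ?case
  proof (cases "v = u")
    case False
    then obtain w where w: "(w, v) \<in> parcs G" "f v = Suc (f w)"
      using distance_from_pred[OF assms(2) less.prems] by blast
    then show ?thesis
      using arc[OF w] less.hyps[of w] in_arcsD1[OF w(1)] by simp
  qed (use start in simp)
qed

text \<open>Following predecessors back to \<open>u\<close> yields a walk of length
  \<open>f v\<close>. Along any walk \<open>f\<close> grows by at most one per arc, so no walk is
  shorter.\<close>

lemma graph_dist_eqI:
  assumes "pair_graph G" "distance_from G u f" "v \<in> pverts G"
  shows "graph_dist G u v = f v"
proof -
  interpret pair_graph G by fact
  have u: "u \<in> pverts G" "f u = 0"
    using assms(2) by (auto simp: distance_from_def)
  have ex: "\<exists>p. awalk u p v \<and> length p = f v"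
    using assms
  proof (induction rule: distance_from_induct)
    case start
    then show ?case using u by (auto simp: awalk_Nil_iff)
  next
    case (arc w v)
    then obtain p where p: "awalk u p w" "length p = f w" by blast
    have "awalk w [(w, v)] v"
      using arc.hyps(1) by (auto simp: awalk_simps dest: in_arcsD2)
    then have "awalk u (p @ [(w, v)]) v"
      by (rule awalk_appendI[OF p(1)])
    then show ?case using p arc.hyps by (intro exI[of _ "p @ [(w, v)]"]) simp
  qed
  have le: "f v \<le> f x + length p" if "awalk x p v" for x p
    using that
  proof (induction p arbitrary: x)
    case Nil
    then show ?case by (simp add: awalk_Nil_iff)
  next
    case (Cons e p)
    then have e: "(x, snd e) \<in> parcs G" "awalk (snd e) p v"
      by (auto simp: awalk_Cons_iff)
    then show ?case
      using Cons.IH[OF e(2)] distance_from_arc[OF assms(2) e(1)] by simp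
  qed
  show ?thesis
    unfolding graph_dist_def
    by (rule Least_equality) (use ex le[of u] u in auto)
qed

text \<open>A shortest walk to \<open>v\<close> with its last arc removed ends one step nearer to
  \<open>u\<close>, which supplies the predecessor.\<close>

lemma distance_from_graph_dist:
  assumes "pair_graph G" "connected G" "u \<in> pverts G"
  shows "distance_from G u (graph_dist G u)"
proof -
  interpret pair_graph G by fact
  have le: "graph_dist G u v \<le> length p" if "awalk u p v" for v p
    unfolding graph_dist_def by (rule Least_le) (use that in blast)
  have ex: "\<exists>p. awalk u p v \<and> length p = graph_dist G u v" if "v \<in> pverts G" for v
  proof -
    have "u \<rightarrow>\<^sup>*\<^bsub>mk_symmetric G\<^esub> v"
      using assms that by (auto simp: connected_def strongly_connected_def)
    then have "u \<rightarrow>\<^sup>*\<^bsub>with_proj G\<^esub> v"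
      using reachable_mk_symmetric_eq[OF sym_arcs] by simp
    then obtain p where "awalk u p v" by (auto simp: reachable_awalk)
    then show ?thesis
      unfolding graph_dist_def
      by (intro LeastI[of "\<lambda>n. \<exists>p. awalk u p v \<and> length p = n" "length p"]) blast
  qed
  have arc: "graph_dist G u v \<le> Suc (graph_dist G u w)" if "(w, v) \<in> parcs G" for w v
  proof -
    obtain p where p: "awalk u p w" "length p = graph_dist G u w"
      using ex \<open>(w, v) \<in> parcs G\<close> in_arcsD1 by blast
    have "awalk w [(w, v)] v"
      using that by (auto simp: awalk_simps dest: in_arcsD2)
    from le[OF awalk_appendI[OF p(1) this]] show ?thesis using p(2) by simp
  qed
  have pred: "\<exists>w. (w, v) \<in> parcs G \<and> graph_dist G u v = Suc (graph_dist G u w)"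
    if v: "v \<in> pverts G" "v \<noteq> u" for v
  proof -
    obtain p where p: "awalk u p v" "length p = graph_dist G u v" using ex v by blast
    show ?thesis
    proof (cases p rule: rev_cases)
      case Nil
      then show ?thesis using p v by (simp add: awalk_Nil_iff)
    next
      case (snoc q e)
      then have q: "awalk u q (fst e)" "(fst e, v) \<in> parcs G"
        using p(1) by (auto simp: awalk_Cons_iff awalk_Nil_iff)
      then have "graph_dist G u v = Suc (graph_dist G u (fst e))"
        using le[OF q(1)] arc[OF q(2)] p(2) snoc by simp
      then show ?thesis using q(2) by blast
    qed
  qed
  have "graph_dist G u u = 0"
    using le[of "[]" u] assms(3) by (simp add: awalk_Nil_iff)
  then show ?thesis
    using arc pred assms(3) by (auto simp: distance_from_def)
qed

text \<open>A step back lowers the coordinate with the larger distance and keeps the other one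
  fixed. On a tie both coordinates move at once, which the diagonal arcs of the strong product
  allow.\<close>

lemma distance_from_strong_product:
  assumes G: "pair_graph G" and H: "pair_graph H"
    and f: "distance_from G a f" and g: "distance_from H b g"
  shows "distance_from (G \<boxtimes> H) (a, b) (\<lambda>(x, y). max (f x) (g y))"
proof -
  interpret G: pair_graph G by fact
  interpret H: pair_graph H by fact
  have pred: "\<exists>x' y'. ((x', y'), (x, y)) \<in> parcs (G \<boxtimes> H) \<and> max (f x) (g y) = Suc (max (f x') (g y'))"
    if xy: "x \<in> pverts G" "y \<in> pverts H" "x \<noteq> a \<or> y \<noteq> b" for x y
  proof (cases "f x" "g y" rule: linorder_cases)
    case less
    then have "y \<noteq> b" using g xy by (auto simp: distance_from_def)
    then obtain y' where "(y', y) \<in> parcs H" "g y = Suc (g y')"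
      using distance_from_pred[OF g xy(2)] by blast
    then show ?thesis
      using less xy by (intro exI[of _ x] exI[of _ y']) (auto simp: strong_product_def dest: H.in_arcsD1)
  next
    case greater
    then have "x \<noteq> a" using f xy by (auto simp: distance_from_def)
    then obtain x' where "(x', x) \<in> parcs G" "f x = Suc (f x')"
      using distance_from_pred[OF f xy(1)] by blast
    then show ?thesis
      using greater xy by (intro exI[of _ x'] exI[of _ y]) (auto simp: strong_product_def dest: G.in_arcsD1)
  next
    case equal
    then have "x \<noteq> a" "y \<noteq> b"
      using xy distance_from_eq_0_iff[OF f xy(1)] distance_from_eq_0_iff[OF g xy(2)] by auto
    then obtain x' y' where "(x', x) \<in> parcs G" "f x = Suc (f x')" "(y', y) \<in> parcs H" "g y = Suc (g y')"
      using distance_from_pred[OF f xy(1)] distance_from_pred[OF g xy(2)] by metis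
    then show ?thesis
      using xy by (intro exI[of _ x'] exI[of _ y'])
        (auto simp: strong_product_def dest: G.in_arcsD1 H.in_arcsD1)
  qed
  have arc: "max (f x') (g y') \<le> Suc (max (f x) (g y))"
    if "((x, y), (x', y')) \<in> parcs (G \<boxtimes> H)" for x y x' y'
  proof -
    have "f x' \<le> Suc (f x)" "g y' \<le> Suc (g y)"
      using that distance_from_arc[OF f] distance_from_arc[OF g] by (auto simp: strong_product_def)
    then show ?thesis by linarith
  qed
  show ?thesis
    unfolding distance_from_def
  proof (intro conjI)
    show "(a, b) \<in> pverts (G \<boxtimes> H)" "(case (a, b) of (x, y) \<Rightarrow> max (f x) (g y)) = 0"
      using f g by (auto simp: distance_from_def strong_product_def)
    show "\<forall>(w, v) \<in> parcs (G \<boxtimes> H). (case v of (x, y) \<Rightarrow> max (f x) (g y))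
        \<le> Suc (case w of (x, y) \<Rightarrow> max (f x) (g y))"
      using arc by auto
    show "\<forall>v \<in> pverts (G \<boxtimes> H) - {(a, b)}. \<exists>w. (w, v) \<in> parcs (G \<boxtimes> H) \<and>
        (case v of (x, y) \<Rightarrow> max (f x) (g y)) = Suc (case w of (x, y) \<Rightarrow> max (f x) (g y))"
      \<comment> \<open>Only the vertex set of the product is unfolded. Its arcs stay folded so that
        \<open>pred\<close> still matches.\<close>
      using pred by (fastforce simp: strong_product_def[THEN arg_cong[where f = pverts]])
  qed
qed

section \<open>Triangle inequality and bipartite parity\<close>

lemma distance_from_triangle:
  assumes G: "pair_graph G" and "distance_from G u f" "distance_from G v g" "b \<in> pverts G"
  shows "f v \<le> f b + g b"
proof -
  interpret pair_graph G by fact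
  show ?thesis
    using G assms(3,4)
  proof (induction rule: distance_from_induct)
    case (arc w b)
    have "(b, w) \<in> parcs G"
      using arc.hyps(1) sym_arcs by (auto simp: symmetric_def dest: symD)
    then show ?case
      using distance_from_arc[OF assms(2)] arc by fastforce
  qed simp
qed

text \<open>The parity of \<open>f x\<close> records whether \<open>x\<close> lies on the same side
  of the bipartition as \<open>u\<close>, and an arc changes sides.\<close>

lemma bipartite_distance_from_neq:
  assumes G: "pair_graph G" and "bipartite G" and f: "distance_from G u f"
    and "(b, d) \<in> parcs G"
  shows "f b \<noteq> f d"
proof -
  interpret pair_graph G by fact
  obtain A B where AB: "A \<inter> B = {}"
    "\<forall>(x, y) \<in> parcs G. x \<in> A \<and> y \<in> B \<or> x \<in> B \<and> y \<in> A"
    using assms(2) unfolding bipartite_def by blast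
  have sides: "x \<in> A \<longleftrightarrow> y \<notin> A" if "(x, y) \<in> parcs G" for x y
    using bspec[OF AB(2) that] AB(1) by auto
  have "even (f x) \<longleftrightarrow> (x \<in> A \<longleftrightarrow> u \<in> A)" if "x \<in> pverts G" for x
    using G f that
  proof (induction rule: distance_from_induct)
    case start
    then show ?case using f by (simp add: distance_from_def)
  next
    case (arc w v)
    then show ?case using sides[of w v] by auto
  qed
  then show ?thesis
    using sides[OF assms(4)] in_arcsD1[OF assms(4)] in_arcsD2[OF assms(4)] by metis
qed

section \<open>Distances in the cycle and its strong product with \<open>G\<close>\<close>

text \<open>With truncated subtraction, \<open>(i - a) + (a - i)\<close> is the absolute difference.
  The minimum then selects the shorter way round the cycle.\<close>

definition cycle_dist :: "nat \<Rightarrow> nat \<Rightarrow> nat \<Rightarrow> nat" where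
  "cycle_dist t i a = min ((i - a) + (a - i)) (t - ((i - a) + (a - i)))"

lemma cycle_graph_arc_iff:
  "(a, c) \<in> parcs (cycle_graph t) \<longleftrightarrow> a < t \<and> c < t \<and>
     (c = Suc a \<or> a = Suc c \<or> c = 0 \<and> Suc a = t \<or> a = 0 \<and> Suc c = t)"
proof (cases "a < t \<and> c < t")
  case True
  then have "Suc a mod t = (if Suc a = t then 0 else Suc a)"
    "Suc c mod t = (if Suc c = t then 0 else Suc c)"
    by auto
  then show ?thesis using True by (auto simp: cycle_graph_def)
qed (auto simp: cycle_graph_def)

lemma distance_from_cycle:
  assumes "i < t"
  shows "distance_from (cycle_graph t) i (cycle_dist t i)"
  unfolding distance_from_def
proof (intro conjI)
  show "i \<in> pverts (cycle_graph t)" "cycle_dist t i i = 0"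
    using assms by (auto simp: cycle_graph_def cycle_dist_def)
  have "cycle_dist t i v \<le> Suc (cycle_dist t i w)" if "(w, v) \<in> parcs (cycle_graph t)" for w v
  proof -
    have wv: "w < t" "v < t"
      and "v = Suc w \<or> w = Suc v \<or> v = 0 \<and> Suc w = t \<or> w = 0 \<and> Suc v = t"
      using that by (auto simp: cycle_graph_arc_iff)
    from this(3) show ?thesis
      using wv assms by (elim disjE conjE; cases "i \<le> w"; cases "i \<le> v"; simp add: cycle_dist_def; linarith)
  qed
  then show "\<forall>(w, v) \<in> parcs (cycle_graph t). cycle_dist t i v \<le> Suc (cycle_dist t i w)"
    by blast
  show "\<forall>v \<in> pverts (cycle_graph t) - {i}. \<exists>w. (w, v) \<in> parcs (cycle_graph t) \<and>
      cycle_dist t i v = Suc (cycle_dist t i w)"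
  proof
    fix v assume "v \<in> pverts (cycle_graph t) - {i}"
    then have v: "v < t" "v \<noteq> i" by (auto simp: cycle_graph_def)
    \<comment> \<open>The cases say on which side of \<open>i\<close> the vertex \<open>v\<close>
      lies and which way round is shorter. The predecessor is the next vertex that way. The cases
      \<open>Suc v = t\<close> and \<open>v = 0\<close> cross the seam between \<open>t - 1\<close>
      and \<open>0\<close>.\<close>
    consider "i < v" "2 * (v - i) \<le> t" | "i < v" "t < 2 * (v - i)" "Suc v < t"
      | "i < v" "t < 2 * (v - i)" "Suc v = t" | "v < i" "2 * (i - v) \<le> t"
      | "v < i" "t < 2 * (i - v)" "0 < v" | "v < i" "t < 2 * (i - v)" "v = 0"
      using v by linarith
    then show "\<exists>w. (w, v) \<in> parcs (cycle_graph t) \<and> cycle_dist t i v = Suc (cycle_dist t i w)"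
    proof cases
      case 1
      then show ?thesis using v assms by (intro exI[of _ "v - 1"]) (auto simp: cycle_graph_arc_iff cycle_dist_def)
    next
      case 2
      then show ?thesis using v assms by (intro exI[of _ "Suc v"]) (auto simp: cycle_graph_arc_iff cycle_dist_def)
    next
      case 3
      then show ?thesis using v assms by (intro exI[of _ 0]) (auto simp: cycle_graph_arc_iff cycle_dist_def)
    next
      case 4
      then show ?thesis using v assms by (intro exI[of _ "Suc v"]) (auto simp: cycle_graph_arc_iff cycle_dist_def)
    next
      case 5
      then show ?thesis using v assms by (intro exI[of _ "v - 1"]) (auto simp: cycle_graph_arc_iff cycle_dist_def)
    next
      case 6
      then show ?thesis using v assms by (intro exI[of _ "t - 1"]) (auto simp: cycle_graph_arc_iff cycle_dist_def)
    qed
  qed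
qed

lemma graph_dist_cycle_strong_product:
  assumes "3 \<le> t" "pair_graph G" "connected G" "i < t" "g \<in> pverts G" "a < t" "b \<in> pverts G"
  shows "graph_dist (cycle_graph t \<boxtimes> G) (i, g) (a, b) = max (cycle_dist t i a) (graph_dist G g b)"
  using graph_dist_eqI[OF pair_graph_strong_product[OF pair_graph_cycle_graph[OF assms(1)] assms(2)]
      distance_from_strong_product[OF pair_graph_cycle_graph[OF assms(1)] assms(2)
        distance_from_cycle[OF assms(4)] distance_from_graph_dist[OF assms(2,3,5)]], of "(a, b)"]
    assms(6,7)
  by (simp add: strong_product_def cycle_graph_def)

section \<open>Diameter and local metric dimension\<close>

lemma finite_graph_distances:
  assumes "pair_graph G"
  shows "finite {graph_dist G u v | u v. u \<in> pverts G \<and> v \<in> pverts G}"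
proof -
  interpret pair_graph G by fact
  have "{graph_dist G u v | u v. u \<in> pverts G \<and> v \<in> pverts G}
      = (\<lambda>(u, v). graph_dist G u v) ` (pverts G \<times> pverts G)"
    by auto
  then show ?thesis using pair_finite_verts by simp
qed

lemma graph_dist_le_diameter:
  assumes "pair_graph G" "u \<in> pverts G" "v \<in> pverts G"
  shows "graph_dist G u v \<le> graph_diameter G"
  unfolding graph_diameter_def
  by (rule Max_ge[OF finite_graph_distances[OF assms(1)]]) (use assms in blast)

lemma graph_diameter_attained:
  assumes "pair_graph G" "pverts G \<noteq> {}"
  obtains u v where "u \<in> pverts G" "v \<in> pverts G" "graph_dist G u v = graph_diameter G"
proof -
  have "graph_diameter G \<in> {graph_dist G u v | u v. u \<in> pverts G \<and> v \<in> pverts G}"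
    unfolding graph_diameter_def
    by (rule Max_in[OF finite_graph_distances[OF assms(1)]]) (use assms(2) in blast)
  then show ?thesis using that by auto
qed

lemma connected_ex_arc:
  assumes "pair_graph G" "connected G" "2 \<le> card (pverts G)" "v \<in> pverts G"
  obtains w where "(v, w) \<in> parcs G"
proof -
  interpret pair_graph G by fact
  have "\<not> pverts G \<subseteq> {v}"
    using assms(3) card_mono[of "{v}" "pverts G"] by auto
  then obtain u where "u \<in> pverts G" "v \<noteq> u" by blast
  then obtain w where "(w, v) \<in> parcs G"
    using distance_from_pred[OF distance_from_graph_dist[OF assms(1,2)] assms(4)] by metis
  then have "(v, w) \<in> parcs G"
    using sym_arcs by (auto simp: symmetric_def dest: symD)
  then show ?thesis by (rule that)
qed

lemma graph_diameter_pos: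
  assumes "pair_graph G" "connected G" "2 \<le> card (pverts G)"
  shows "0 < graph_diameter G"
proof -
  interpret pair_graph G by fact
  obtain v where v: "v \<in> pverts G" using assms(3) by fastforce
  then obtain w where vw: "(v, w) \<in> parcs G" using connected_ex_arc[OF assms] by blast
  then have w: "w \<in> pverts G" "v \<noteq> w" using in_arcsD2[OF vw] pair_no_loops[OF vw] by auto
  have "graph_dist G v w \<noteq> 0"
    using distance_from_eq_0_iff[OF distance_from_graph_dist[OF assms(1,2) v] w(1)] w(2) by simp
  then show ?thesis
    using graph_dist_le_diameter[OF assms(1) v w(1)] by simp
qed

lemma local_metric_dim_le:
  "finite S \<Longrightarrow> local_metric_generator G S \<Longrightarrow> dim\<^sub>l G \<le> card S"
  unfolding local_metric_dim_def by (rule Least_le) blast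

lemma local_metric_dim_attained:
  assumes "finite S" "local_metric_generator G S"
  obtains T where "finite T" "local_metric_generator G T" "card T = dim\<^sub>l G"
  using LeastI[of "\<lambda>n. \<exists>S. finite S \<and> local_metric_generator G S \<and> card S = n" "card S"] assms
  unfolding local_metric_dim_def by blast

section \<open>The lower bound\<close>

text \<open>Unrolling the cycle around \<open>i\<close> embeds this ball in an open integer interval
  of radius \<open>D\<close>.\<close>

lemma card_cycle_dist_less:
  assumes "i < t"
  shows "card {a. a < t \<and> cycle_dist t i a < D} \<le> 2 * D - 1"
proof -
  \<comment> \<open>\<open>wrap a\<close> is congruent to \<open>a\<close> modulo \<open>t\<close>.
    For \<open>a < t\<close> its three branches give values in the ranges from \<open>0\<close> to
    \<open>t - 1\<close>, below \<open>0\<close>, and from \<open>t\<close> on, hence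
    injectivity.\<close>
  define wrap where "wrap a = (if nat \<bar>int a - int i\<bar> < D then int a else if i < a then int a - int t
    else int a + int t)" for a
  have "inj_on wrap {a. a < t \<and> cycle_dist t i a < D}"
    by (rule inj_onI) (auto simp: wrap_def split: if_splits)
  moreover have "wrap ` {a. a < t \<and> cycle_dist t i a < D} \<subseteq> {int i - int D <..< int i + int D}"
  proof (intro image_subsetI)
    fix a assume "a \<in> {a. a < t \<and> cycle_dist t i a < D}"
    then have "a < t" "cycle_dist t i a < D" by auto
    then show "wrap a \<in> {int i - int D <..< int i + int D}"
      using assms by (cases "a \<le> i") (auto simp: wrap_def cycle_dist_def min_def split: if_splits)
  qed
  ultimately have "card {a. a < t \<and> cycle_dist t i a < D} \<le> card {int i - int D <..< int i + int D}"
    by (intro card_inj_on_le) auto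
  then show ?thesis by simp
qed

text \<open>Double counting of \<open>weight\<close>: the \<open>t\<close> columns each receive at
  least 2, while each element of \<open>S\<close> gives at most twice the diameter.\<close>

lemma local_metric_generator_cycle_strong_product_card_ge:
  assumes G: "pair_graph G" "connected G" "2 \<le> card (pverts G)" and t: "3 \<le> t"
    and S: "finite S" "local_metric_generator (cycle_graph t \<boxtimes> G) S"
  shows "t \<le> graph_diameter G * card S"
proof -
  interpret pair_graph G by fact
  let ?D = "graph_diameter G"
  define weight :: "nat \<times> 'a \<Rightarrow> nat \<Rightarrow> nat" where
    "weight s a = of_bool (fst s = a) + of_bool (cycle_dist t (fst s) a < ?D)" for s a
  have S_verts: "fst s < t" "snd s \<in> pverts G" if "s \<in> S" for s
    using S(2) that by (auto simp: local_metric_generator_def strong_product_def cycle_graph_def)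
  have resolve: "\<exists>s \<in> S. max (cycle_dist t (fst s) a) (graph_dist G (snd s) b)
      \<noteq> max (cycle_dist t (fst s) a) (graph_dist G (snd s) d)"
    if "a < t" "(b, d) \<in> parcs G" for a b d
  proof -
    have bd: "b \<in> pverts G" "d \<in> pverts G"
      using that in_arcsD1 in_arcsD2 by auto
    have "((a, b), (a, d)) \<in> parcs (cycle_graph t \<boxtimes> G)"
      using that bd by (auto simp: strong_product_def cycle_graph_def)
    then obtain s where s: "s \<in> S"
      "graph_dist (cycle_graph t \<boxtimes> G) s (a, b) \<noteq> graph_dist (cycle_graph t \<boxtimes> G) s (a, d)"
      using S(2) unfolding local_metric_generator_def by blast
    have dist: "graph_dist (cycle_graph t \<boxtimes> G) s (a, x) = max (cycle_dist t (fst s) a) (graph_dist G (snd s) x)"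
      if "x \<in> pverts G" for x
      using graph_dist_cycle_strong_product[OF t G(1,2) S_verts[OF s(1)] \<open>a < t\<close> that] by simp
    show ?thesis
      using s dist bd by (intro bexI[of _ s]) auto
  qed
  \<comment> \<open>If the cycle distance were at least the diameter, it would equal both maxima and
    hide the distances in \<open>G\<close>.\<close>
  have near: "cycle_dist t (fst s) a < ?D"
    if "s \<in> S" "(b, d) \<in> parcs G" "max (cycle_dist t (fst s) a) (graph_dist G (snd s) b)
      \<noteq> max (cycle_dist t (fst s) a) (graph_dist G (snd s) d)" for s a b d
    using that(3) graph_dist_le_diameter[OF G(1) S_verts(2)[OF that(1)] in_arcsD1[OF that(2)]]
      graph_dist_le_diameter[OF G(1) S_verts(2)[OF that(1)] in_arcsD2[OF that(2)]]
    by linarith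
  have column: "2 \<le> (\<Sum>s\<in>S. weight s a)" if a: "a < t" for a
  proof -
    obtain v where "v \<in> pverts G" using G(3) by fastforce
    then obtain w where vw: "(v, w) \<in> parcs G" using connected_ex_arc[OF G] by blast
    obtain s where s: "s \<in> S" "max (cycle_dist t (fst s) a) (graph_dist G (snd s) v)
        \<noteq> max (cycle_dist t (fst s) a) (graph_dist G (snd s) w)"
      using resolve[OF a vw] by blast
    note near_s = near[OF s(1) vw s(2)]
    show ?thesis
    proof (cases "fst s = a")
      case True
      then have "weight s a = 2" using near_s by (simp add: weight_def)
      then show ?thesis using member_le_sum[of s S "\<lambda>s. weight s a"] s(1) S(1) by simp
    next
      case False
      let ?g = "snd s"
      have pos: "cycle_dist t (fst s) a \<noteq> 0"
        using distance_from_eq_0_iff[OF distance_from_cycle[OF S_verts(1)[OF s(1)]], of a] a False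
        by (simp add: cycle_graph_def)
      \<comment> \<open>An arc at the second coordinate of \<open>s\<close> itself has end distances
        0 and at most 1. The positive cycle distance masks both, so another element
        \<open>s'\<close> must resolve it.\<close>
      obtain w' where gw: "(?g, w') \<in> parcs G"
        using connected_ex_arc[OF G S_verts(2)[OF s(1)]] by blast
      obtain s' where s': "s' \<in> S" "max (cycle_dist t (fst s') a) (graph_dist G (snd s') ?g)
          \<noteq> max (cycle_dist t (fst s') a) (graph_dist G (snd s') w')"
        using resolve[OF a gw] by blast
      note from_g = distance_from_graph_dist[OF G(1,2) S_verts(2)[OF s(1)]]
      have "graph_dist G ?g ?g = 0" "graph_dist G ?g w' \<le> 1"
        using from_g distance_from_arc[OF from_g gw] by (auto simp: distance_from_def)
      then have "s' \<noteq> s" using s'(2) pos by auto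
      then have "2 \<le> (\<Sum>x\<in>{s, s'}. weight x a)"
        using near_s near[OF s'(1) gw s'(2)] by (simp add: weight_def)
      also have "\<dots> \<le> (\<Sum>x\<in>S. weight x a)"
        using s(1) s'(1) S(1) by (intro sum_mono2) auto
      finally show ?thesis .
    qed
  qed
  have row: "(\<Sum>a<t. weight s a) \<le> 2 * ?D" if "s \<in> S" for s
  proof -
    have "(\<Sum>a<t. weight s a) = 1 + card {a. a < t \<and> cycle_dist t (fst s) a < ?D}"
      using S_verts(1)[OF that] by (simp add: weight_def sum.distrib of_bool_def sum.If_cases Int_def)
    \<comment> \<open>A positive diameter is what turns \<open>1 + (2 * ?D - 1)\<close> into
      \<open>2 * ?D\<close> under truncated subtraction.\<close>
    then show ?thesis
      using card_cycle_dist_less[OF S_verts(1)[OF that], of ?D] graph_diameter_pos[OF G] by simp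
  qed
  have "2 * t = (\<Sum>a<t. 2)" by simp
  also have "\<dots> \<le> (\<Sum>a<t. \<Sum>s\<in>S. weight s a)" by (intro sum_mono) (use column in simp)
  also have "\<dots> = (\<Sum>s\<in>S. \<Sum>a<t. weight s a)" by (rule sum.swap)
  also have "\<dots> \<le> (\<Sum>s\<in>S. 2 * ?D)" by (intro sum_mono row)
  also have "\<dots> = 2 * (?D * card S)" by simp
  finally show ?thesis by simp
qed

section \<open>The upper bound\<close>

text \<open>Column \<open>a\<close> lies in a gap of length at most \<open>D\<close> between
  neighbouring points, and neighbouring indices differ in parity. Capping at \<open>t - 1\<close>
  keeps every point on the cycle.\<close>

lemma alternating_points_bracket:
  assumes D: "0 < D" and t: "t \<le> k * D" and n: "even n" "n = k \<or> n = Suc k" and a: "a < t"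
  obtains i j where "i < n" "j < n" "even i" "odd j"
    "cycle_dist t (min (i * D) (t - 1)) a + cycle_dist t (min (j * D) (t - 1)) a \<le> D"
proof -
  define q where "q = a div D"
  have q: "q * D \<le> a" "a < q * D + D"
    using div_mult_mod_eq[of a D] mod_less_divisor[OF D, of a] unfolding q_def by linarith+
  have "q < k"
    unfolding q_def using a t by (intro less_mult_imp_div_less) simp
  have near: "cycle_dist t (min (q * D) (t - 1)) a \<le> a - q * D"
    using q a by (simp add: cycle_dist_def)
  show ?thesis
  proof (cases "Suc q < n")
    case True
    have "cycle_dist t (min (Suc q * D) (t - 1)) a \<le> q * D + D - a"
      unfolding cycle_dist_def using q a by (intro min.coboundedI1) auto
    then have "cycle_dist t (min (q * D) (t - 1)) a + cycle_dist t (min (Suc q * D) (t - 1)) a \<le> D"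
      using near q by linarith
    then show ?thesis
      using that[of q "Suc q"] that[of "Suc q" q] True by (cases "even q") (auto simp: add.commute)
  next
    case False
    \<comment> \<open>Here \<open>a\<close> lies in the closing gap, from the last point round to
      point 0. As \<open>n\<close> is even, the last index \<open>q\<close> is odd and the parities
      still differ.\<close>
    then have "Suc q = n" "n = k" using \<open>q < k\<close> n(2) by auto
    then have "odd q" "t \<le> q * D + D" using n(1) t by auto
    moreover have "cycle_dist t (min (0 * D) (t - 1)) a \<le> t - a"
      by (simp add: cycle_dist_def)
    ultimately show ?thesis
      using that[of 0 q] near q a \<open>Suc q = n\<close> by auto
  qed
qed

text \<open>The lower bound \<open>D\<close> on both cycle distances prevents the distances in
  \<open>G\<close> from masking their difference in the product.\<close>

lemma points_resolve_cycle_arc: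
  assumes D: "0 < D" "4 * D \<le> t" and t: "t \<le> k * D" and n: "k \<le> n"
    and arc: "(a, c) \<in> parcs (cycle_graph t)"
  obtains j where "j < n" "D \<le> cycle_dist t (min (j * D) (t - 1)) a"
    "D \<le> cycle_dist t (min (j * D) (t - 1)) c"
    "cycle_dist t (min (j * D) (t - 1)) a \<noteq> cycle_dist t (min (j * D) (t - 1)) c"
proof -
  \<comment> \<open>With \<open>c\<close> the successor of \<open>a\<close>, a point ahead of
    \<open>a\<close> at distance more than \<open>D\<close> and at most \<open>2 * D\<close>
    qualifies: since \<open>2 * D\<close> is at most half of \<open>t\<close>, moving to
    \<open>c\<close> brings it one step nearer.\<close>
  have forward: "\<exists>j<n. D < cycle_dist t (min (j * D) (t - 1)) a \<and>
      cycle_dist t (min (j * D) (t - 1)) a = Suc (cycle_dist t (min (j * D) (t - 1)) c)"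
    if a: "a < t" and c: "c = (if Suc a = t then 0 else Suc a)" for a c
  proof -
    have in_range: "j < n" if "j * D < t" for j
    proof -
      have "j * D < k * D" using that t by linarith
      then show ?thesis using n by simp
    qed
    have div: "(m div D) * D \<le> m" "m < (m div D) * D + D" for m
      using div_mult_mod_eq[of m D] mod_less_divisor[OF D(1), of m] by linarith+
    define q where "q = a div D"
    have q: "q * D \<le> a" "a < q * D + D" unfolding q_def by (rule div)+
    \<comment> \<open>The point ahead has index \<open>q + 2\<close> if that lies before the seam.
      Otherwise it is point 0 when this is farther than \<open>D\<close>, and else the last point
      within \<open>2 * D\<close> ahead, counted across the seam.\<close>
    consider "q * D + 2 * D < t" | "t \<le> q * D + 2 * D" "a + D < t" | "t \<le> a + D" by linarith
    then show ?thesis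
    proof cases
      case 1
      have "(q + 2) * D = q * D + 2 * D" by (simp add: algebra_simps)
      then show ?thesis
        using 1 q D in_range[of "q + 2"] c
        by (intro exI[of _ "q + 2"]) (simp add: cycle_dist_def, intro conjI; linarith)
    next
      case 2
      then show ?thesis
        using q D in_range[of 0] c
        by (intro exI[of _ 0]) (simp add: cycle_dist_def, intro conjI; linarith)
    next
      case 3
      define r where "r = (a + 2 * D - t) div D"
      have r: "r * D \<le> a + 2 * D - t" "a + 2 * D - t < r * D + D" unfolding r_def by (rule div)+
      show ?thesis
        using 3 r D a in_range[of r] c by (intro exI[of _ r]) (auto simp: cycle_dist_def)
    qed
  qed
  have "a < t" "c < t" "c = (if Suc a = t then 0 else Suc a) \<or> a = (if Suc c = t then 0 else Suc c)"
    using arc by (auto simp: cycle_graph_arc_iff)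
  then show ?thesis
    using forward[of a c] forward[of c a] that by fastforce
qed

lemma local_metric_generator_cycle_strong_product:
  assumes G: "pair_graph G" "connected G" "bipartite G"
    and D: "0 < graph_diameter G" "4 * graph_diameter G \<le> t"
    and t: "t \<le> k * graph_diameter G" and n: "even n" "n = k \<or> n = Suc k"
    and uv: "u \<in> pverts G" "v \<in> pverts G" "graph_dist G u v = graph_diameter G"
  shows "local_metric_generator (cycle_graph t \<boxtimes> G)
    ((\<lambda>j. (min (j * graph_diameter G) (t - 1), if even j then u else v)) ` {..<n})"
proof -
  interpret pair_graph G by fact
  define D where "D = graph_diameter G"
  note D = D[folded D_def] and t = t[folded D_def] and uv = uv[folded D_def]
  define p where "p j = min (j * D) (t - 1)" for j
  define s where "s j = (p j, if even j then u else v)" for j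
  have p: "p j < t" for j using D by (auto simp: p_def)
  have dist: "graph_dist (cycle_graph t \<boxtimes> G) (s j) (a, b)
      = max (cycle_dist t (p j) a) (graph_dist G (if even j then u else v) b)"
    if "a < t" "b \<in> pverts G" for j a b
    unfolding s_def
    by (rule graph_dist_cycle_strong_product) (use D G p uv that in auto)
  have resolved: "\<exists>j<n. graph_dist (cycle_graph t \<boxtimes> G) (s j) (a, b)
      \<noteq> graph_dist (cycle_graph t \<boxtimes> G) (s j) (c, d)"
    if arc: "((a, b), (c, d)) \<in> parcs (cycle_graph t \<boxtimes> G)" for a b c d
  proof -
    have verts: "a < t" "c < t" "b \<in> pverts G" "d \<in> pverts G"
      using arc by (auto simp: strong_product_def cycle_graph_def)
    consider "(a, c) \<in> parcs (cycle_graph t)" | "a = c" "(b, d) \<in> parcs G"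
      using arc by (auto simp: strong_product_def)
    then show ?thesis
    proof cases
      case 1
      have "k \<le> n" using n(2) by auto
      obtain j where j: "j < n" "D \<le> cycle_dist t (p j) a" "D \<le> cycle_dist t (p j) c"
        "cycle_dist t (p j) a \<noteq> cycle_dist t (p j) c"
        using points_resolve_cycle_arc[OF D t \<open>k \<le> n\<close> 1] unfolding p_def by blast
      have "graph_dist G (if even j then u else v) x \<le> D" if "x \<in> pverts G" for x
        unfolding D_def using graph_dist_le_diameter[OF G(1)] uv(1,2) that by auto
      from this[OF verts(3)] this[OF verts(4)] j show ?thesis
        by (intro exI[of _ j]) (auto simp: dist verts)
    next
      case 2
      obtain i j where ij: "i < n" "j < n" "even i" "odd j"
        "cycle_dist t (p i) a + cycle_dist t (p j) a \<le> D"
        using alternating_points_bracket[OF D(1) t n verts(1)] unfolding p_def by blast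
      note from_u = distance_from_graph_dist[OF G(1,2) uv(1)]
        and from_v = distance_from_graph_dist[OF G(1,2) uv(2)]
      have tri: "D \<le> graph_dist G u x + graph_dist G v x" if "x \<in> pverts G" for x
        using distance_from_triangle[OF G(1) from_u from_v that] uv(3) by simp
      have neq: "graph_dist G u b \<noteq> graph_dist G u d" "graph_dist G v b \<noteq> graph_dist G v d"
        using bipartite_distance_from_neq[OF G(1,3) _ 2(2)] from_u from_v by auto
      \<comment> \<open>If both failed, the cycle distances would bound the distances of
        \<open>b\<close> and \<open>d\<close> from \<open>u\<close> and from \<open>v\<close>. Their
        sum is at most \<open>D\<close>, so \<open>tri\<close> forces equality throughout, giving
        \<open>b\<close> and \<open>d\<close> the same distance from \<open>u\<close>.\<close>
      have "max (cycle_dist t (p i) a) (graph_dist G u b) \<noteq> max (cycle_dist t (p i) a) (graph_dist G u d)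
        \<or> max (cycle_dist t (p j) a) (graph_dist G v b) \<noteq> max (cycle_dist t (p j) a) (graph_dist G v d)"
        using neq tri[OF verts(3)] tri[OF verts(4)] ij(5) by linarith
      then show ?thesis
        using dist[OF verts(1,3), of i] dist[OF verts(1,3), of j]
          dist[OF verts(1,4), of i] dist[OF verts(1,4), of j] ij(1-4) 2(1) by auto
    qed
  qed
  have "s ` {..<n} \<subseteq> pverts (cycle_graph t \<boxtimes> G)"
    using p uv by (auto simp: s_def strong_product_def cycle_graph_def)
  then have "local_metric_generator (cycle_graph t \<boxtimes> G) (s ` {..<n})"
    using resolved by (fastforce simp: local_metric_generator_def)
  moreover have "s = (\<lambda>j. (min (j * graph_diameter G) (t - 1), if even j then u else v))"
    by (simp add: fun_eq_iff s_def p_def D_def)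
  ultimately show ?thesis by simp
qed

theorem theorem22:
  fixes G :: "'a pair_pre_digraph" and t :: nat
  assumes "pair_graph G" and "Digraph_Component.connected G" and "bipartite G"
    and nontrivial: "card (pverts G) \<ge> 2"
    and t: "t \<ge> 4 * graph_diameter G"
  shows "int (dim\<^sub>l (cycle_graph t \<boxtimes> G)) \<le> \<lceil>real t / real (graph_diameter G)\<rceil> + 1
    \<and> (even \<lceil>real t / real (graph_diameter G)\<rceil> \<longrightarrow>
         int (dim\<^sub>l (cycle_graph t \<boxtimes> G)) = \<lceil>real t / real (graph_diameter G)\<rceil>)"
proof -
  let ?D = "graph_diameter G" and ?P = "cycle_graph t \<boxtimes> G"
  let ?c = "\<lceil>real t / real ?D\<rceil>"
  have D: "0 < ?D" by (rule graph_diameter_pos[OF assms(1,2) nontrivial])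
  define k where "k = nat ?c"
  \<comment> \<open>This makes the ceiling nonnegative, so passing to the natural number
    \<open>k\<close> loses nothing.\<close>
  have "- 1 < real t / real ?D"
    by (rule less_le_trans[of _ 0]) simp_all
  then have k: "?c = int k" by (simp add: k_def)
  have "real t / real ?D \<le> real k"
    using le_of_int_ceiling[of "real t / real ?D"] by (simp add: k)
  then have "real t \<le> real (k * ?D)" using D by (simp add: field_simps)
  then have tk: "t \<le> k * ?D" by (simp only: of_nat_le_iff)
  have "pverts G \<noteq> {}" using nontrivial by auto
  then obtain u v where uv: "u \<in> pverts G" "v \<in> pverts G" "graph_dist G u v = ?D"
    using graph_diameter_attained[OF assms(1)] by blast
  define S where "S n = (\<lambda>j. (min (j * ?D) (t - 1), if even j then u else v)) ` {..<n}" for n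
  have gen: "finite (S n)" "local_metric_generator ?P (S n)" "card (S n) \<le> n"
    if "even n" "n = k \<or> n = Suc k" for n
    using local_metric_generator_cycle_strong_product[OF assms(1-3) D t tk that uv]
      card_image_le[of "{..<n}"] by (auto simp: S_def)
  \<comment> \<open>Used with \<open>k\<close> itself when \<open>k\<close> is even, and with
    \<open>Suc k\<close> when it is odd, which accounts for the extra 1 in the general
    bound.\<close>
  have upper: "dim\<^sub>l ?P \<le> n" if "even n" "n = k \<or> n = Suc k" for n
    using local_metric_dim_le[OF gen(1,2)[OF that]] gen(3)[OF that] by linarith
  show ?thesis
  proof (cases "even k")
    case True
    obtain T where T: "finite T" "local_metric_generator ?P T" "card T = dim\<^sub>l ?P"
      using local_metric_dim_attained[OF gen(1,2)] True by blast
    have "t \<le> ?D * dim\<^sub>l ?P"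
      using local_metric_generator_cycle_strong_product_card_ge[OF assms(1,2) nontrivial _ T(1,2)] T(3) D t
      by simp
    then have "real t \<le> real ?D * real (dim\<^sub>l ?P)"
      by (metis of_nat_le_iff of_nat_mult)
    then have "real t / real ?D \<le> real (dim\<^sub>l ?P)"
      using D by (simp add: field_simps)
    then have "?c \<le> int (dim\<^sub>l ?P)" by (simp add: ceiling_le_iff)
    then show ?thesis using upper[of k] True k by simp
  next
    case False
    then show ?thesis using upper[of "Suc k"] k by simp
  qed
qed

end
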